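(* Let $\mathbf k$ be a field of characteristic $0$, $\lambda\in\mathbf k$, and $\mathfrak g,\mathfrak h$ vector spaces over $\mathbf k$. Let $\pi\in\mathrm{Hom}(\wedge^2\mathfrak g,\mathfrak g)$, $\rho\in\mathrm{Hom}(\mathfrak g\otimes\mathfrak h,\mathfrak h)$, $\mu\in\mathrm{Hom}(\wedge^2\mathfrak h,\mathfrak h)$ and $D\in\mathrm{Hom}(\mathfrak g,\mathfrak h)$. Then $(s(\pi+\rho+\mu),D)$ is a Maurer-Cartan element of the $L_\infty[1]$-algebra $sM'\oplus A'$ (described in the context, depending on $\lambda$) if and only if $((\mathfrak g,\pi),(\mathfrak h,\mu),\rho)$ is a LieAct triple and $D$ is a relative differential operator of weight $\lambda$ on it.
   Context: A LieAct triple is $(\mathfrak g,\mathfrak h,\rho)$ with $(\mathfrak g,[\,,]_{\mathfrak g})$, $(\mathfrak h,[\,,]_{\mathfrak h})$ Lie algebras and $\rho:\mathfrak g\to\mathrm{Der}(\mathfrak h)$ a Lie algebra homomorphism (here $[\,,]_{\mathfrak g}=\pi$, $[\,,]_{\mathfrak h}=\mu$, $\rho(x)u=\rho(x\otimes u)$). A linear map $D:\mathfrak g\to\mathfrak h$ is a relative differential operator of weight $\lambda$ if $D([x,y]_{\mathfrak g})=\rho(x)(D(y))-\rho(y)(D(x))+\lambda[D(x),D(y)]_{\mathfrak h}$ for all $x,y\in\mathfrak g$. $\bar\wedge V=\bigoplus_{k\ge1}\wedge^kV$. $\mathrm{Hom}(\bar\wedge V,V)$ has $\mathrm{Hom}(\wedge^{n+1}V,V)$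 in degree $n$ and is a graded Lie algebra under $[f,g]_{\mathrm{NR}}=f\bar\circ g-(-1)^{pq}g\bar\circ f$ for $f,g$ of degrees $p,q$, where $f\bar\circ g(x_1,\dots,x_{p+q+1})=\sum_{\sigma\in\mathrm{Sh}(q+1,p)}\mathrm{sgn}(\sigma)f(g(x_{\sigma(1)},\dots,x_{\sigma(q+1)}),x_{\sigma(q+2)},\dots,x_{\sigma(p+q+1)})$. Let $L'=\mathrm{Hom}(\bar\wedge(\mathfrak g\oplus\mathfrak h),\mathfrak g\oplus\mathfrak h)$ with this bracket. Via $\wedge^n(\mathfrak g\oplus\mathfrak h)\cong\bigoplus_{k+l=n}\wedge^k\mathfrak g\otimes\wedge^l\mathfrak h$, regard $F\in\mathrm{Hom}(\wedge^k\mathfrak g\otimes\wedge^l\mathfrak h,X)$, $X\in\{\mathfrak g,\mathfrak h\}$, as the element $(x_1+u_1)\wedge\dots\wedge(x_n+u_n)\mapsto\sum_{\sigma\in\mathrm{Sh}(k,l)}\mathrm{sgn}(\sigma)F(x_{\sigma(1)}\wedge\dots\wedge x_{\sigma(k)}\otimes u_{\sigma(k+1)}\wedge\dots\wedge u_{\sigma(n)})$ of $L'$. Let $$M'=\mathrm{Hom}(\bar\wedge\mathfrak g,\mathfrak g)\oplus\mathrm{Hom}(\bar\wedge\mathfrak g\otimes\bar\wedge\mathfrak h,\mathfrak h)\oplus\mathrm{Hom}(\bar\wedge\mathfrak h,\mathfrak h)\subset L',\quad A'=\mathrm{Hom}(\bar\wedge\mathfrak g,\mathfrak h)\subset L',$$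 and $P':L'\to A'$ the natural projection; $M'$ is a graded Lie subalgebra of $L'$. With $(sV)^n=V^{n+1}$, the $L_\infty[1]$-algebra $sM'\oplus A'$ has operations $l_2(sf,sg)=(-1)^{|f|}s[f,g]_{\mathrm{NR}}$ and $l_i(sf,\xi_1,\dots,\xi_{i-1})=\lambda^{i-2}P'[\cdots[f,\xi_1]_{\mathrm{NR}},\cdots,\xi_{i-1}]_{\mathrm{NR}}$ ($i\ge2$) for $f,g\in M'$, $\xi_j\in A'$, extended by graded symmetry, all other components being zero. A Maurer-Cartan element is a degree $0$ element $\alpha$ with $\sum_{n\ge1}\frac1{n!}l_n(\alpha^{\otimes n})=0$. *)

theory Defs
  imports
    "HOL-Analysis.Product_Vector"
    "HOL-Combinatorics.Permutations"
    "HOL-Library.Function_Algebras"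
begin

section \<open>LieAct triples and relative differential operators\<close>

definition bilinear_map ::
  "('k::field \<Rightarrow> 'a::ab_group_add \<Rightarrow> 'a) \<Rightarrow> ('k \<Rightarrow> 'b::ab_group_add \<Rightarrow> 'b) \<Rightarrow>
   ('k \<Rightarrow> 'c::ab_group_add \<Rightarrow> 'c) \<Rightarrow> ('a \<Rightarrow> 'b \<Rightarrow> 'c) \<Rightarrow> bool" where
  "bilinear_map s1 s2 s3 B \<longleftrightarrow>
     (\<forall>x. Vector_Spaces.linear s2 s3 (B x)) \<and>
     (\<forall>y. Vector_Spaces.linear s1 s3 (\<lambda>x. B x y))"

text \<open>Elements of \<open>Hom(\<wedge>\<^sup>2 V, V)\<close>.\<close>

definition alternating_bilinear ::
  "('k::field \<Rightarrow> 'v::ab_group_add \<Rightarrow> 'v) \<Rightarrow> ('v \<Rightarrow> 'v \<Rightarrow> 'v) \<Rightarrow> bool" where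
  "alternating_bilinear s B \<longleftrightarrow> bilinear_map s s s B \<and> (\<forall>x. B x x = 0)"

locale lie_algebra = vector_space scale
  for scale :: "'k::field \<Rightarrow> 'v::ab_group_add \<Rightarrow> 'v" +
  fixes bracket :: "'v \<Rightarrow> 'v \<Rightarrow> 'v"
  assumes bracket_alternating: "alternating_bilinear scale bracket"
    and jacobi: "bracket x (bracket y z) + bracket y (bracket z x) + bracket z (bracket x y) = 0"

definition derivation ::
  "('k::field \<Rightarrow> 'v::ab_group_add \<Rightarrow> 'v) \<Rightarrow> ('v \<Rightarrow> 'v \<Rightarrow> 'v) \<Rightarrow> ('v \<Rightarrow> 'v) \<Rightarrow> bool" where
  "derivation s b d \<longleftrightarrow>
     Vector_Spaces.linear s s d \<and> (\<forall>u v. d (b u v) = b (d u) v + b u (d v))"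

text \<open>The three assumptions on \<open>act\<close> say that it is a homomorphism of Lie algebras into
  \<open>Der(\<hh>)\<close> with the commutator bracket.\<close>

locale lie_act = G: lie_algebra sg brg + H: lie_algebra sh brh
  for sg :: "'k::field \<Rightarrow> 'g::ab_group_add \<Rightarrow> 'g" and brg :: "'g \<Rightarrow> 'g \<Rightarrow> 'g"
    and sh :: "'k \<Rightarrow> 'h::ab_group_add \<Rightarrow> 'h" and brh :: "'h \<Rightarrow> 'h \<Rightarrow> 'h" +
  fixes act :: "'g \<Rightarrow> 'h \<Rightarrow> 'h"
  assumes act_derivation: "derivation sh brh (act x)"
    and act_linear: "Vector_Spaces.linear sg sh (\<lambda>x. act x u)"
    and act_bracket: "act (brg x y) u = act x (act y u) - act y (act x u)"

definition rel_diff_op ::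
  "('k::field \<Rightarrow> 'g::ab_group_add \<Rightarrow> 'g) \<Rightarrow> ('g \<Rightarrow> 'g \<Rightarrow> 'g) \<Rightarrow>
   ('k \<Rightarrow> 'h::ab_group_add \<Rightarrow> 'h) \<Rightarrow> ('h \<Rightarrow> 'h \<Rightarrow> 'h) \<Rightarrow>
   ('g \<Rightarrow> 'h \<Rightarrow> 'h) \<Rightarrow> 'k \<Rightarrow> ('g \<Rightarrow> 'h) \<Rightarrow> bool" where
  "rel_diff_op sg brg sh brh act wt D \<longleftrightarrow>
     Vector_Spaces.linear sg sh D \<and>
     (\<forall>x y. D (brg x y) = act x (D y) - act y (D x) + sh wt (brh (D x) (D y)))"


section \<open>Alternating multilinear maps and the Nijenhuis--Richardson bracket\<close>

text \<open>An element of \<open>Hom(\<wedge>\<^sup>n V, W)\<close> is an alternating multilinear function of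
  argument lists of length \<open>n\<close>, extended by \<open>0\<close> to all other lists.  A function on
  arbitrary lists thus collects components of all arities at once, and
  \<open>Hom(\<wedge>\<^sup>n\<^sup>+\<^sup>1 V, V)\<close>, supported on length \<open>n + 1\<close>, is the part of degree \<open>n\<close>.\<close>

definition alt_maps ::
  "('k::field \<Rightarrow> 'v::ab_group_add \<Rightarrow> 'v) \<Rightarrow> ('k \<Rightarrow> 'w::ab_group_add \<Rightarrow> 'w) \<Rightarrow> nat \<Rightarrow>
   ('v list \<Rightarrow> 'w) set" where
  "alt_maps s1 s2 n = {f.
     (\<forall>xs. length xs \<noteq> n \<longrightarrow> f xs = 0) \<and>
     (\<forall>xs. \<forall>i<n. length xs = n \<longrightarrow> Vector_Spaces.linear s1 s2 (\<lambda>x. f (xs[i := x]))) \<and>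
     (\<forall>xs. length xs = n \<and> \<not> distinct xs \<longrightarrow> f xs = 0)}"

text \<open>\<open>Hom(\<wedge>\<^sup>k \<gg> \<otimes> \<wedge>\<^sup>l \<hh>, X)\<close>.\<close>

definition bialt_maps ::
  "('k::field \<Rightarrow> 'g::ab_group_add \<Rightarrow> 'g) \<Rightarrow> ('k \<Rightarrow> 'h::ab_group_add \<Rightarrow> 'h) \<Rightarrow>
   ('k \<Rightarrow> 'x::ab_group_add \<Rightarrow> 'x) \<Rightarrow> nat \<Rightarrow> nat \<Rightarrow> ('g list \<Rightarrow> 'h list \<Rightarrow> 'x) set" where
  "bialt_maps sg sh sx k l = {F.
     (\<forall>us. (\<lambda>xs. F xs us) \<in> alt_maps sg sx k) \<and> (\<forall>xs. F xs \<in> alt_maps sh sx l)}"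

text \<open>\<open>(i, j)\<close>-shuffles, as permutations of \<open>{0..<i + j}\<close>.\<close>

definition Sh :: "nat \<Rightarrow> nat \<Rightarrow> (nat \<Rightarrow> nat) set" where
  "Sh i j = {\<sigma>. \<sigma> permutes {..<i + j} \<and>
     strict_mono_on {..<i} \<sigma> \<and> strict_mono_on {i..<i + j} \<sigma>}"

text \<open>\<open>nr_circ s p q f g\<close> is the Nijenhuis--Richardson composition of
  \<open>f\<close> with \<open>g\<close>, for \<open>f\<close>, \<open>g\<close> of degrees \<open>p\<close>, \<open>q\<close>, to be applied to
  lists of length \<open>p + q + 1\<close>.\<close>

definition nr_circ ::
  "('k::field \<Rightarrow> 'v::ab_group_add \<Rightarrow> 'v) \<Rightarrow> nat \<Rightarrow> nat \<Rightarrow>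
   ('v list \<Rightarrow> 'v) \<Rightarrow> ('v list \<Rightarrow> 'v) \<Rightarrow> 'v list \<Rightarrow> 'v" where
  "nr_circ s p q f g xs =
     (\<Sum>\<sigma>\<in>Sh (q + 1) p. s (of_int (sign \<sigma>))
        (f (g (map (\<lambda>i. xs ! \<sigma> i) [0..<q + 1]) # map (\<lambda>i. xs ! \<sigma> i) [q + 1..<p + q + 1])))"

text \<open>The bracket, extended bilinearly to inhomogeneous arguments: on a list of length \<open>n\<close> it
  is the sum, over all \<open>p + q + 1 = n\<close>, of the brackets of the degree \<open>p\<close> part of \<open>f\<close> with
  the degree \<open>q\<close> part of \<open>g\<close>.  For homogeneous \<open>f\<close>, \<open>g\<close> a single summand survives.\<close>

definition nr_bracket ::
  "('k::field \<Rightarrow> 'v::ab_group_add \<Rightarrow> 'v) \<Rightarrow>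
   ('v list \<Rightarrow> 'v) \<Rightarrow> ('v list \<Rightarrow> 'v) \<Rightarrow> 'v list \<Rightarrow> 'v" where
  "nr_bracket s f g xs =
     (\<Sum>(p, q)\<in>{(p, q). p + q + 1 = length xs}.
        nr_circ s p q f g xs - s ((-1) ^ (p * q)) (nr_circ s q p g f xs))"


section \<open>The graded spaces \<open>M'\<close> and \<open>A'\<close> inside \<open>L'\<close>\<close>

type_synonym ('g, 'h) multimap = "('g \<times> 'h) list \<Rightarrow> 'g \<times> 'h"

definition lift ::
  "('k::field \<Rightarrow> 'x::ab_group_add \<Rightarrow> 'x) \<Rightarrow> nat \<Rightarrow> nat \<Rightarrow> ('g list \<Rightarrow> 'h list \<Rightarrow> 'x) \<Rightarrow>
   ('g \<times> 'h) list \<Rightarrow> 'x" where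
  "lift s k l F xs = (if length xs = k + l then
     (\<Sum>\<sigma>\<in>Sh k l. s (of_int (sign \<sigma>))
        (F (map (\<lambda>i. fst (xs ! \<sigma> i)) [0..<k]) (map (\<lambda>i. snd (xs ! \<sigma> i)) [k..<k + l])))
     else 0)"

definition lift_g ::
  "('k::field \<Rightarrow> 'g::ab_group_add \<Rightarrow> 'g) \<Rightarrow> nat \<Rightarrow> nat \<Rightarrow> ('g list \<Rightarrow> 'h list \<Rightarrow> 'g) \<Rightarrow>
   ('g, 'h::ab_group_add) multimap" where
  "lift_g sg k l F = (\<lambda>xs. (lift sg k l F xs, 0))"

definition lift_h ::
  "('k::field \<Rightarrow> 'h::ab_group_add \<Rightarrow> 'h) \<Rightarrow> nat \<Rightarrow> nat \<Rightarrow> ('g list \<Rightarrow> 'h list \<Rightarrow> 'h) \<Rightarrow>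
   ('g::ab_group_add, 'h) multimap" where
  "lift_h sh k l F = (\<lambda>xs. (0, lift sh k l F xs))"

text \<open>The degree \<open>n\<close> part of \<open>M'\<close>.\<close>

definition Mspace ::
  "('k::field \<Rightarrow> 'g::ab_group_add \<Rightarrow> 'g) \<Rightarrow> ('k \<Rightarrow> 'h::ab_group_add \<Rightarrow> 'h) \<Rightarrow> nat \<Rightarrow>
   ('g, 'h) multimap set" where
  "Mspace sg sh n =
     {lift_g sg (n + 1) 0 a + (\<Sum>k=1..n. lift_h sh k (n + 1 - k) (b k)) + lift_h sh 0 (n + 1) c
      | a b c. a \<in> bialt_maps sg sh sg (n + 1) 0 \<and>
        (\<forall>k\<in>{1..n}. b k \<in> bialt_maps sg sh sh k (n + 1 - k)) \<and>
        c \<in> bialt_maps sg sh sh 0 (n + 1)}"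

text \<open>The degree \<open>n\<close> part of \<open>A'\<close>.\<close>

definition Aspace ::
  "('k::field \<Rightarrow> 'g::ab_group_add \<Rightarrow> 'g) \<Rightarrow> ('k \<Rightarrow> 'h::ab_group_add \<Rightarrow> 'h) \<Rightarrow> nat \<Rightarrow>
   ('g, 'h) multimap set" where
  "Aspace sg sh n = {lift_h sh (n + 1) 0 a | a. a \<in> bialt_maps sg sh sh (n + 1) 0}"

text \<open>The projection keeps the \<open>\<hh>\<close>-valued component of a map that takes all its arguments from
  \<open>\<gg>\<close>; the three lemmas below identify it as the projection of
  \<open>\<Oplus>\<^sub>k\<^sub>,\<^sub>l Hom(\<wedge>\<^sup>k \<gg> \<otimes> \<wedge>\<^sup>l \<hh>, \<gg> \<oplus> \<hh>)\<close> onto \<open>A'\<close>.\<close>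

definition Pproj :: "('g::ab_group_add, 'h::ab_group_add) multimap \<Rightarrow> ('g, 'h) multimap" where
  "Pproj f = (\<lambda>xs. (0, snd (f (map (\<lambda>x. (fst x, 0)) xs))))"

lemma Pproj_lift_g: "Pproj (lift_g sg k l F) = 0"
  by (simp add: Pproj_def lift_g_def fun_eq_iff zero_prod_def)

lemma Pproj_lift_h_0: "Pproj (lift_h sh k 0 F) = lift_h sh k 0 F"
proof -
  have *: "fst ((map (\<lambda>x. (fst x, 0)) xs) ! \<sigma> i) = fst (xs ! \<sigma> i)"
    if "\<sigma> \<in> Sh k 0" "i < k" "length xs = k"
    for \<sigma> i and xs :: "('a \<times> 'b) list"
  proof -
    have "\<sigma> i < length xs"
      using that permutes_in_image[of \<sigma> "{..<k}" i] by (simp add: Sh_def)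
    then show ?thesis by simp
  qed
  have "lift sh k 0 F (map (\<lambda>x. (fst x, 0)) xs) = lift sh k 0 F xs" for xs
    unfolding lift_def by (auto intro!: sum.cong arg_cong2[where f = sh] arg_cong2[where f = F] simp: *)
  then show ?thesis
    by (simp add: Pproj_def lift_h_def)
qed

lemma Pproj_lift_h:
  fixes sh :: "'k::field \<Rightarrow> 'h::ab_group_add \<Rightarrow> 'h"
    and F :: "'g::ab_group_add list \<Rightarrow> 'h list \<Rightarrow> 'h"
  assumes "l > 0" and F: "F \<in> bialt_maps sg sh sh k l" and "vector_space sh"
  shows "Pproj (lift_h sh k l F) = 0"
proof -
  interpret vector_space sh by fact
  have zero: "F ys us = 0" if us: "length us = l" "us ! 0 = 0" for ys us
  proof -
    have "Vector_Spaces.linear sh sh (\<lambda>u. F ys (us[0 := u]))"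
      using F us \<open>l > 0\<close> by (auto simp: bialt_maps_def alt_maps_def)
    then have "F ys (us[0 := 0]) = 0"
      unfolding Vector_Spaces.linear_def by (blast dest: module_hom.zero)
    then show ?thesis using us by (metis list_update_id)
  qed
  have "lift sh k l F (map (\<lambda>x. (fst x, 0)) xs) = 0" for xs :: "('g \<times> 'h) list"
  proof (cases "length xs = k + l")
    case True
    have "F ys (map (\<lambda>i. snd (map (\<lambda>x. (fst x, 0)) xs ! \<sigma> i)) [k..<k + l]) = 0"
      if "\<sigma> \<in> Sh k l" for \<sigma> ys
    proof -
      have "\<sigma> k < length xs"
        using that True \<open>l > 0\<close> permutes_in_image[of \<sigma> "{..<k + l}" k] by (simp add: Sh_def)
      then show ?thesis using \<open>l > 0\<close> by (intro zero) auto
    qed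
    then show ?thesis by (simp add: lift_def)
  qed (simp add: lift_def)
  then show ?thesis
    by (simp add: Pproj_def lift_h_def fun_eq_iff zero_prod_def)
qed


section \<open>The \<open>L\<^sub>\<infinity>[1]\<close>-algebra \<open>sM' \<oplus> A'\<close>\<close>

text \<open>An element is a pair \<open>(f, \<xi>)\<close> standing for \<open>(sf, \<xi>)\<close>.  As \<open>(sM')\<^sup>d\<close> is the part of
  \<open>M'\<close> of degree \<open>d + 1\<close>, the smallest degree is \<open>-1\<close>.\<close>

definition sMA_space ::
  "('k::field \<Rightarrow> 'g::ab_group_add \<Rightarrow> 'g) \<Rightarrow> ('k \<Rightarrow> 'h::ab_group_add \<Rightarrow> 'h) \<Rightarrow> int \<Rightarrow>
   (('g, 'h) multimap \<times> ('g, 'h) multimap) set" where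
  "sMA_space sg sh d =
     (if d \<ge> -1 then Mspace sg sh (nat (d + 1)) else {0}) \<times>
     (if d \<ge> 0 then Aspace sg sh (nat d) else {0})"

definition scale_map :: "('k \<Rightarrow> 'w \<Rightarrow> 'w) \<Rightarrow> 'k \<Rightarrow> ('v \<Rightarrow> 'w) \<Rightarrow> 'v \<Rightarrow> 'w" where
  "scale_map s c f = (\<lambda>x. s c (f x))"

text \<open>\<open>l_MM\<close> is \<open>l\<^sub>2(sf, sg)\<close> for \<open>f\<close> of degree \<open>m\<close> in \<open>M'\<close>; \<open>l_MA\<close> is
  \<open>l\<^sub>i(sf, \<xi>\<^sub>1, \<dots>, \<xi>\<^sub>i\<^sub>-\<^sub>1)\<close>, where \<open>i - 2\<close> is written as \<open>length \<xi>s - 1\<close>.\<close>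

definition l_MM ::
  "('k::field \<Rightarrow> 'g::ab_group_add \<Rightarrow> 'g) \<Rightarrow> ('k \<Rightarrow> 'h::ab_group_add \<Rightarrow> 'h) \<Rightarrow> int \<Rightarrow>
   ('g, 'h) multimap \<Rightarrow> ('g, 'h) multimap \<Rightarrow> ('g, 'h) multimap" where
  "l_MM sg sh m f g =
     (let s = module_prod.scale sg sh in scale_map s ((-1) powi m) (nr_bracket s f g))"

definition l_MA ::
  "('k::field \<Rightarrow> 'g::ab_group_add \<Rightarrow> 'g) \<Rightarrow> ('k \<Rightarrow> 'h::ab_group_add \<Rightarrow> 'h) \<Rightarrow> 'k \<Rightarrow>
   ('g, 'h) multimap \<Rightarrow> ('g, 'h) multimap list \<Rightarrow> ('g, 'h) multimap" where
  "l_MA sg sh wt f \<xi>s =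
     (let s = module_prod.scale sg sh
      in scale_map s (wt ^ (length \<xi>s - 1)) (Pproj (foldl (nr_bracket s) f \<xi>s)))"

text \<open>The operation \<open>l\<^sub>n\<close> on homogeneous elements, each given as \<open>(d, f, \<xi>)\<close> with \<open>d\<close> the degree of
  \<open>(sf, \<xi>)\<close>.  Expanding multilinearly, the terms that survive have either two arguments, both in
  \<open>sM'\<close>, or exactly one argument \<open>sf\<^sub>i\<close> from \<open>sM'\<close>, which graded symmetry moves to the front
  at the cost of the Koszul sign \<open>(-1) powi (d\<^sub>i (d\<^sub>1 + \<dots> + d\<^sub>i\<^sub>-\<^sub>1))\<close>.\<close>

definition l_op ::
  "('k::field \<Rightarrow> 'g::ab_group_add \<Rightarrow> 'g) \<Rightarrow> ('k \<Rightarrow> 'h::ab_group_add \<Rightarrow> 'h) \<Rightarrow> 'k \<Rightarrow>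
   (int \<times> ('g, 'h) multimap \<times> ('g, 'h) multimap) list \<Rightarrow>
   ('g, 'h) multimap \<times> ('g, 'h) multimap" where
  "l_op sg sh wt as =
     (let n = length as; d = map fst as; f = map (fst \<circ> snd) as; \<xi> = map (snd \<circ> snd) as in
      (if n = 2 then l_MM sg sh (d ! 0 + 1) (f ! 0) (f ! 1) else 0,
       if n \<ge> 2 then
         (\<Sum>i<n. scale_map (module_prod.scale sg sh) ((-1) powi (d ! i * sum_list (take i d)))
            (l_MA sg sh wt (f ! i) (take i \<xi> @ drop (Suc i) \<xi>)))
       else 0))"

text \<open>The Maurer--Cartan series is required to have only finitely many nonzero terms; this holds
  automatically for \<open>\<alpha>\<close> of degree \<open>0\<close>.\<close>

definition maurer_cartan ::
  "('k::field_char_0 \<Rightarrow> 'g::ab_group_add \<Rightarrow> 'g) \<Rightarrow> ('k \<Rightarrow> 'h::ab_group_add \<Rightarrow> 'h) \<Rightarrow> 'k \<Rightarrow>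
   ('g, 'h) multimap \<times> ('g, 'h) multimap \<Rightarrow> bool" where
  "maurer_cartan sg sh wt \<alpha> \<longleftrightarrow>
     \<alpha> \<in> sMA_space sg sh 0 \<and>
     (let l = (\<lambda>n. l_op sg sh wt (replicate n (0, \<alpha>)));
          N = {n. n \<ge> 1 \<and> l n \<noteq> 0};
          scale = (\<lambda>c. scale_map (module_prod.scale sg sh) c)
      in finite N \<and>
         (\<Sum>n\<in>N. map_prod (scale (1 / fact n)) (scale (1 / fact n)) (l n)) = 0)"


section \<open>Structure maps as elements of \<open>L'\<close>\<close>

definition of_pi :: "('g \<Rightarrow> 'g \<Rightarrow> 'g) \<Rightarrow> 'g list \<Rightarrow> 'h list \<Rightarrow> 'g::zero" where
  "of_pi \<pi> xs us = (case (xs, us) of ([x, y], []) \<Rightarrow> \<pi> x y | _ \<Rightarrow> 0)"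

definition of_rho :: "('g \<Rightarrow> 'h \<Rightarrow> 'h) \<Rightarrow> 'g list \<Rightarrow> 'h list \<Rightarrow> 'h::zero" where
  "of_rho \<rho> xs us = (case (xs, us) of ([x], [u]) \<Rightarrow> \<rho> x u | _ \<Rightarrow> 0)"

definition of_mu :: "('h \<Rightarrow> 'h \<Rightarrow> 'h) \<Rightarrow> 'g list \<Rightarrow> 'h list \<Rightarrow> 'h::zero" where
  "of_mu \<mu> xs us = (case (xs, us) of ([], [u, v]) \<Rightarrow> \<mu> u v | _ \<Rightarrow> 0)"

definition of_D :: "('g \<Rightarrow> 'h) \<Rightarrow> 'g list \<Rightarrow> 'h list \<Rightarrow> 'h::zero" where
  "of_D D xs us = (case (xs, us) of ([x], []) \<Rightarrow> D x | _ \<Rightarrow> 0)"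

end

theory Submission
  imports Defs
begin

text \<open>The sum \<open>\<theta> = \<pi> + \<rho> + \<mu>\<close> is the semidirect product bracket on \<open>\<gg> \<oplus> \<hh>\<close>.  The
  \<open>sM'\<close>-component of the Maurer--Cartan series is \<open>- [\<theta>, \<theta>] / 2\<close>, the negative of the Jacobiator
  of \<open>\<theta>\<close>; it vanishes iff \<open>\<theta>\<close> is a Lie bracket, which is the LieAct condition.
  The derived brackets of \<open>\<theta>\<close> along \<open>D\<close> terminate, since
  \<open>D\<close> vanishes on \<open>\<hh>\<close>: \<open>[[[\<theta>, D], D], D] = 0\<close>.  So the \<open>A'\<close>-component is
  \<open>P'[\<theta>, D] + (\<lambda> / 2) P'[[\<theta>, D], D]\<close>, and this is the defect
  of \<open>D\<close> from being a relative differential operator of weight \<open>\<lambda>\<close>.\<close>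

section \<open>Shuffles of at most three points\<close>

lemma Sh_0_right: "Sh n 0 = {id}"
  and Sh_0_left: "Sh 0 n = {id}"
proof -
  have "\<sigma> = id" if \<sigma>: "\<sigma> permutes {..<n}" and mono: "strict_mono_on {..<n} \<sigma>" for \<sigma> :: "nat \<Rightarrow> nat"
  proof -
    \<comment> \<open>With one block empty, \<open>\<sigma>\<close> increases on all of
      \<open>{..<n}\<close>, so it never moves a point down; only the identity permutation does
      that.\<close>
    have ge: "i < n \<Longrightarrow> i \<le> \<sigma> i" for i
    proof (induction i)
      case (Suc i)
      then have "\<sigma> i < \<sigma> (Suc i)" by (intro strict_mono_onD[OF mono]) auto
      with Suc show ?case by simp
    qed simp
    show ?thesis
      using permutes_natset_ge[OF \<sigma>] ge by simp
  qed
  then show "Sh n 0 = {id}" "Sh 0 n = {id}"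
    by (auto simp: Sh_def lessThan_atLeast0 intro!: strict_mono_onI)
qed

lemma Sh_1_1: "Sh 1 1 = {id, transpose 0 1}"
proof
  \<comment> \<open>In this form \<open>permutes_insert\<close> enumerates all permutations.
    Monotonicity on one-point blocks is vacuous, so both are shuffles.\<close>
  have *: "{..<2::nat} = insert 0 (insert 1 {})" by auto
  have "{\<sigma>. \<sigma> permutes {..<2::nat}} \<subseteq> {id, transpose 0 1}"
    unfolding * permutes_insert by auto
  then show "Sh 1 1 \<subseteq> {id, transpose 0 1}"
    unfolding Sh_def one_add_one by blast
  have "\<sigma> \<in> Sh 1 1" if "\<sigma> permutes {..<2}" for \<sigma>
    using that unfolding Sh_def one_add_one by (auto intro!: strict_mono_onI)
  moreover have "transpose 0 1 permutes {..<2::nat}"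
    by (simp add: permutes_swap_id)
  ultimately show "{id, transpose 0 1} \<subseteq> Sh 1 1"
    by (simp add: permutes_id)
qed

text \<open>The shuffle condition reduces to \<open>\<sigma> 0 < \<sigma> 1\<close>, which selects
  three of the six permutations. The last one is the 3-cycle sending 0, 1, 2 to 1, 2, 0.\<close>

lemma Sh_2_1: "Sh 2 1 = {id, transpose 1 2, transpose 0 1 \<circ> transpose 1 2}"
proof
  have *: "{..<3::nat} = insert 0 (insert 1 (insert 2 {}))" by auto
  have perms: "{\<sigma>. \<sigma> permutes {..<3::nat}} \<subseteq>
    {id, transpose 1 2, transpose 0 1 \<circ> transpose 1 2,
     transpose 0 1, transpose 0 2, transpose 0 2 \<circ> transpose 1 2}"
    unfolding * permutes_insert by auto
  show "Sh 2 1 \<subseteq> {id, transpose 1 2, transpose 0 1 \<circ> transpose 1 2}"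
  proof
    fix \<sigma> assume "\<sigma> \<in> Sh 2 1"
    then have \<sigma>: "\<sigma> permutes {..<3}" and less: "\<sigma> 0 < \<sigma> 1"
      by (simp_all add: Sh_def strict_mono_on_def)
    from \<sigma> perms have "\<sigma> \<in> {id, transpose 1 2, transpose 0 1 \<circ> transpose 1 2,
      transpose 0 1, transpose 0 2, transpose 0 2 \<circ> transpose 1 2}" by blast
    then show "\<sigma> \<in> {id, transpose 1 2, transpose 0 1 \<circ> transpose 1 2}"
      using less by (elim insertE emptyE) simp_all
  qed
  have "\<sigma> \<in> Sh 2 1" if "\<sigma> permutes {..<3}" "\<sigma> 0 < \<sigma> 1" for \<sigma>
    using that by (auto simp: Sh_def intro!: strict_mono_onI simp: less_2_cases_iff)
  moreover have "transpose 1 2 permutes {..<3::nat}" "transpose 0 1 permutes {..<3::nat}"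
    by (simp_all add: permutes_swap_id)
  ultimately show "{id, transpose 1 2, transpose 0 1 \<circ> transpose 1 2} \<subseteq> Sh 2 1"
    by (simp add: permutes_id permutes_compose)
qed

section \<open>Nijenhuis-Richardson brackets and operations in low arity\<close>

lemma nr_circ_inhomogeneous:
  assumes "vector_space s"
    and f: "\<And>ys. length ys \<noteq> p + 1 \<Longrightarrow> f ys = 0" "\<And>ys. f (0 # ys) = 0"
    and g: "\<And>ys. length ys \<noteq> q + 1 \<Longrightarrow> g ys = 0"
    and "(p', q') \<noteq> (p, q)"
  shows "nr_circ s p' q' f g xs = 0"
proof -
  interpret vector_space s by fact
  show ?thesis
    \<comment> \<open>If \<open>q' \<noteq> q\<close>, then \<open>g\<close> gets a list of the
      wrong length and puts 0 into the first slot of \<open>f\<close>. Otherwise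
      \<open>p' \<noteq> p\<close>, and \<open>f\<close> itself gets a list of the wrong
      length.\<close>
    using assms(5) by (cases "q' = q") (simp_all add: nr_circ_def f g)
qed

lemma nr_bracket_homogeneous:
  assumes "vector_space s"
    and f: "\<And>ys. length ys \<noteq> p + 1 \<Longrightarrow> f ys = 0" "\<And>ys. f (0 # ys) = 0"
    and g: "\<And>ys. length ys \<noteq> q + 1 \<Longrightarrow> g ys = 0" "\<And>ys. g (0 # ys) = 0"
  shows "nr_bracket s f g xs = (if length xs = p + q + 1
    then nr_circ s p q f g xs - s ((-1) ^ (p * q)) (nr_circ s q p g f xs) else 0)"
proof -
  interpret vector_space s by fact
  let ?I = "{(p', q'). p' + q' + 1 = length xs}"
  have fin: "finite ?I"
    by (rule finite_subset[of _ "{..length xs} \<times> {..length xs}"]) auto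
  have zero: "nr_circ s p' q' f g xs = 0" "nr_circ s q' p' g f xs = 0"
    if "(p', q') \<noteq> (p, q)" for p' q'
    by (use assms that in \<open>auto intro: nr_circ_inhomogeneous[where p = p and q = q and f = f and g = g]
        nr_circ_inhomogeneous[where p = q and q = p and f = g and g = f]\<close>)
  \<comment> \<open>Only the summand at \<open>(p, q)\<close> survives, and it belongs to the index
    set exactly when the list has length \<open>p + q + 1\<close>.\<close>
  have "nr_bracket s f g xs = (\<Sum>i\<in>?I. if i = (p, q)
    then nr_circ s p q f g xs - s ((-1) ^ (p * q)) (nr_circ s q p g f xs) else 0)"
    unfolding nr_bracket_def
  proof (rule sum.cong)
    fix i :: "nat \<times> nat"
    obtain p' q' where i: "i = (p', q')" by (cases i)
    show "(case i of (p', q') \<Rightarrow>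
        nr_circ s p' q' f g xs - s ((-1) ^ (p' * q')) (nr_circ s q' p' g f xs)) =
      (if i = (p, q)
       then nr_circ s p q f g xs - s ((-1) ^ (p * q)) (nr_circ s q p g f xs) else 0)"
    proof (cases "(p', q') = (p, q)")
      case False
      then show ?thesis using zero[OF False] by (auto simp: i)
    qed (simp add: i)
  qed simp
  then show ?thesis
    using fin by (simp add: sum.delta)
qed

text \<open>\<open>unary\<close> and \<open>binary\<close> turn curried maps into list functions of
  degree 0 and 1, with the default value 0 on other lengths that \<open>alt_maps\<close>
  prescribes.\<close>

definition unary :: "('v \<Rightarrow> 'w) \<Rightarrow> 'v list \<Rightarrow> 'w::zero" where
  "unary T xs = (case xs of [a] \<Rightarrow> T a | _ \<Rightarrow> 0)"

definition binary :: "('v \<Rightarrow> 'v \<Rightarrow> 'w) \<Rightarrow> 'v list \<Rightarrow> 'w::zero" where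
  "binary B xs = (case xs of [a, b] \<Rightarrow> B a b | _ \<Rightarrow> 0)"

lemma unary_simps [simp]:
  "unary T [a] = T a" "length xs \<noteq> Suc 0 \<Longrightarrow> unary T xs = 0"
  by (auto simp: unary_def split: list.split)

lemma binary_simps [simp]:
  "binary B [a, b] = B a b" "length xs \<noteq> 2 \<Longrightarrow> binary B xs = 0"
  by (auto simp: binary_def split: list.split)

lemma unary_zero: "T 0 = 0 \<Longrightarrow> unary T (0 # ys) = 0"
  by (simp add: unary_def split: list.split)

lemma binary_zero: "(\<And>b. B 0 b = 0) \<Longrightarrow> binary B (0 # ys) = 0"
  by (simp add: binary_def split: list.split)

text \<open>For \<open>p = q = 1\<close> the sign \<open>(-1) ^ (p * q)\<close> is -1, so the two
  compositions add up to twice one of them. The three terms come from \<open>Sh 2 1\<close>.\<close>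

lemma nr_bracket_binary_binary:
  assumes "vector_space s" and B: "\<And>b. B 0 b = 0"
  shows "nr_bracket s (binary B) (binary B) xs = (case xs of
    [a, b, c] \<Rightarrow> s 2 (B (B a b) c - B (B a c) b + B (B b c) a) | _ \<Rightarrow> 0)"
proof -
  interpret vector_space s by fact
  \<comment> \<open>The three shuffles must be pairwise distinct for the sum over the set to split
    into three terms.\<close>
  have "transpose 1 2 \<noteq> (id :: nat \<Rightarrow> nat)"
    by (auto dest!: fun_cong[of _ _ 1])
  moreover have "transpose 0 1 \<circ> transpose 1 2 \<noteq> (id :: nat \<Rightarrow> nat)"
    "transpose 0 1 \<circ> transpose 1 2 \<noteq> (transpose 1 2 :: nat \<Rightarrow> nat)"
    by (auto dest!: fun_cong[of _ _ 0])
  moreover have "sign (transpose 0 1 \<circ> transpose 1 (2::nat)) = 1"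
    by (simp add: sign_compose sign_swap_id permutation_swap_id)
  ultimately have "nr_circ s 1 1 (binary B) (binary B) [a, b, c] =
      B (B a b) c - B (B a c) b + B (B b c) a" for a b c
    unfolding nr_circ_def using Sh_2_1
    by (simp add: sign_swap_id transpose_def upt_rec numeral_2_eq_2 numeral_3_eq_3)
  moreover have "nr_bracket s (binary B) (binary B) xs = (if length xs = 3
    then s 2 (nr_circ s 1 1 (binary B) (binary B) xs) else 0)"
    by (subst nr_bracket_homogeneous[where p = 1 and q = 1])
      (simp_all add: assms binary_zero scale_left_distrib[of 1 1, simplified] numeral_3_eq_3)
  ultimately show ?thesis
    by (auto split: list.split)
qed

text \<open>\<open>Sh 1 1\<close> inserts \<open>T\<close> into the first slot of \<open>B\<close>
  after either ordering of the arguments, and \<open>Sh 2 0\<close> gives the term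
  \<open>T (B a b)\<close>. The result is again a \<open>binary\<close>, so brackets with
  \<open>unary T\<close> can be iterated.\<close>

lemma nr_bracket_binary_unary:
  assumes "vector_space s" and B: "\<And>b. B 0 b = 0" and T: "T 0 = 0"
  shows "nr_bracket s (binary B) (unary T) = binary (\<lambda>a b. B (T a) b - B (T b) a - T (B a b))"
proof
  fix xs
  interpret vector_space s by fact
  have "transpose 0 1 \<noteq> (id :: nat \<Rightarrow> nat)"
    by (auto dest!: fun_cong[of _ _ 1] simp: transpose_def)
  then have "nr_circ s 1 0 (binary B) (unary T) [a, b] = B (T a) b - B (T b) a" for a b
    unfolding nr_circ_def using Sh_1_1
    by (simp add: sign_swap_id transpose_def)
  moreover have "nr_circ s 0 1 (unary T) (binary B) [a, b] = T (B a b)" for a b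
    by (simp add: nr_circ_def Sh_0_right)
  ultimately show "nr_bracket s (binary B) (unary T) xs =
      binary (\<lambda>a b. B (T a) b - B (T b) a - T (B a b)) xs"
    by (subst nr_bracket_homogeneous[where p = 1 and q = 0])
      (auto simp: assms binary_zero unary_zero length_Suc_conv numeral_2_eq_2)
qed

text \<open>In degree 0 all Koszul signs are 1, and removing any one of \<open>n\<close> equal
  arguments leaves the same list, so the \<open>n\<close> mixed terms coincide.\<close>

lemma l_op_replicate:
  assumes "vector_space sg" and "vector_space sh"
  shows "l_op sg sh wt (replicate n (0, f, \<xi>)) =
    (if n = 2 then l_MM sg sh 1 f f else 0,
     if n \<ge> 2 then \<Sum>i<n. l_MA sg sh wt f (replicate (n - 1) \<xi>) else 0)"
proof -
  interpret vector_space_prod sg sh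
    using assms by (simp add: vector_space_prod_def vector_space_pair_def)
  have "take i (replicate n \<xi>) @ drop (Suc i) (replicate n \<xi>) = replicate (n - 1) \<xi>"
    if "i < n" for i
    using that by (simp flip: replicate_add)
  then show ?thesis
    by (auto simp: l_op_def Let_def scale_map_def)
qed

section \<open>Alternating maps of arity at most two\<close>

lemma alt_maps_zero:
  assumes "vector_space s1" and "vector_space s2"
  shows "(\<lambda>_. 0) \<in> alt_maps s1 s2 n"
proof -
  interpret vector_space_pair s1 s2
    using assms by (simp add: vector_space_pair_def)
  show ?thesis by (simp add: alt_maps_def linear_zero)
qed

lemma alt_maps_0: "(\<And>xs. xs \<noteq> [] \<Longrightarrow> f xs = 0) \<Longrightarrow> f \<in> alt_maps s1 s2 0"
  by (auto simp: alt_maps_def)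

lemma alt_maps_1: "Vector_Spaces.linear s1 s2 T \<Longrightarrow> unary T \<in> alt_maps s1 s2 1"
  by (auto simp: alt_maps_def length_Suc_conv)

lemma alt_maps_2:
  "alternating_bilinear s B \<Longrightarrow> binary B \<in> alt_maps s s 2"
  by (auto simp: alt_maps_def numeral_2_eq_2 length_Suc_conv less_Suc_eq
      alternating_bilinear_def bilinear_map_def)

section \<open>The semidirect product bracket and its derived brackets along
  \<open>D\<close>\<close>

locale lie_act_data =
  G: vector_space sg + H: vector_space sh
  for sg :: "'k::field_char_0 \<Rightarrow> 'g::ab_group_add \<Rightarrow> 'g"
    and sh :: "'k \<Rightarrow> 'h::ab_group_add \<Rightarrow> 'h" +
  fixes \<pi> :: "'g \<Rightarrow> 'g \<Rightarrow> 'g" and \<rho> :: "'g \<Rightarrow> 'h \<Rightarrow> 'h" and \<mu> :: "'h \<Rightarrow> 'h \<Rightarrow> 'h"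
    and D :: "'g \<Rightarrow> 'h"
  assumes \<pi>: "alternating_bilinear sg \<pi>"
    and \<rho>: "bilinear_map sg sh sh \<rho>"
    and \<mu>: "alternating_bilinear sh \<mu>"
    and D: "Vector_Spaces.linear sg sh D"
begin

sublocale vector_space_prod sg sh ..

lemma \<pi>_linear: "Vector_Spaces.linear sg sg (\<pi> x)" "Vector_Spaces.linear sg sg (\<lambda>x. \<pi> x y)"
  and \<mu>_linear: "Vector_Spaces.linear sh sh (\<mu> u)" "Vector_Spaces.linear sh sh (\<lambda>u. \<mu> u v)"
  and \<rho>_linear: "Vector_Spaces.linear sh sh (\<rho> x)" "Vector_Spaces.linear sg sh (\<lambda>x. \<rho> x u)"
  using \<pi> \<rho> \<mu> by (auto simp: alternating_bilinear_def bilinear_map_def)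

lemmas linear_rules = \<pi>_linear \<mu>_linear \<rho>_linear D

text \<open>\<open>axioms(3)\<close> extracts the \<open>module_hom\<close> part of linearity; the
  structure maps and \<open>D\<close> thus expand automatically.\<close>

lemmas [simp] =
  linear_rules[THEN Vector_Spaces.linear.axioms(3), THEN module_hom.zero]
  linear_rules[THEN Vector_Spaces.linear.axioms(3), THEN module_hom.add]
  linear_rules[THEN Vector_Spaces.linear.axioms(3), THEN module_hom.diff]
  linear_rules[THEN Vector_Spaces.linear.axioms(3), THEN module_hom.neg]
  linear_rules[THEN Vector_Spaces.linear.axioms(3), THEN module_hom.scale]

lemma \<pi>_self [simp]: "\<pi> x x = 0" and \<mu>_self [simp]: "\<mu> u u = 0"
  using \<pi> \<mu> by (auto simp: alternating_bilinear_def)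

lemma \<pi>_swap: "\<pi> x y = - \<pi> y x"
  using \<pi>_self[of "x + y"] by (simp add: eq_neg_iff_add_eq_0 del: \<pi>_self) (simp add: add.commute)

lemma \<mu>_swap: "\<mu> u v = - \<mu> v u"
  using \<mu>_self[of "u + v"] by (simp add: eq_neg_iff_add_eq_0 del: \<mu>_self) (simp add: add.commute)

definition bracket :: "'g \<times> 'h \<Rightarrow> 'g \<times> 'h \<Rightarrow> 'g \<times> 'h" where
  "bracket a b = (\<pi> (fst a) (fst b), \<rho> (fst a) (snd b) - \<rho> (fst b) (snd a) + \<mu> (snd a) (snd b))"

definition D_ext :: "'g \<times> 'h \<Rightarrow> 'g \<times> 'h" where
  "D_ext a = (0, D (fst a))"

text \<open>The shuffle sums for \<pi> and \<mu> have one term each, while \<open>Sh 1 1\<close>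
  antisymmetrises \<rho>, which produces the difference in \<open>bracket\<close>.\<close>

lemma lift_structure:
  "lift_g sg 2 0 (of_pi \<pi>) + lift_h sh 1 1 (of_rho \<rho>) + lift_h sh 0 2 (of_mu \<mu>) = binary bracket"
proof
  fix xs :: "('g \<times> 'h) list"
  have ne: "transpose 0 1 \<noteq> (id :: nat \<Rightarrow> nat)"
    by (auto dest!: fun_cong[of _ _ 1])
  show "(lift_g sg 2 0 (of_pi \<pi>) + lift_h sh 1 1 (of_rho \<rho>) + lift_h sh 0 2 (of_mu \<mu>)) xs
    = binary bracket xs"
  proof (cases "length xs = 2")
    case True
    then obtain a b where xs: "xs = [a, b]"
      by (auto simp: numeral_2_eq_2 length_Suc_conv)
    have "lift sg 2 0 (of_pi \<pi>) [a, b] = \<pi> (fst a) (fst b)"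
      by (simp add: lift_def Sh_0_right of_pi_def upt_rec)
    moreover have "lift sh 0 2 (of_mu \<mu>) [a, b] = \<mu> (snd a) (snd b)"
      by (simp add: lift_def Sh_0_left of_mu_def upt_rec)
    moreover have "lift sh 1 1 (of_rho \<rho>) [a, b] = \<rho> (fst a) (snd b) - \<rho> (fst b) (snd a)"
      using Sh_1_1 ne by (simp add: lift_def of_rho_def sign_swap_id)
    ultimately show ?thesis
      by (simp add: xs lift_g_def lift_h_def bracket_def)
  qed (simp add: lift_g_def lift_h_def lift_def zero_prod_def)
qed

lemma lift_D: "lift_h sh 1 0 (of_D D) = unary D_ext"
proof
  fix xs :: "('g \<times> 'h) list"
  show "lift_h sh 1 0 (of_D D) xs = unary D_ext xs"
    using Sh_0_right[of 1]
    by (cases "length xs = 1")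
      (auto simp: length_Suc_conv lift_h_def lift_def of_D_def D_ext_def zero_prod_def)
qed

lemma bracket_zero: "bracket 0 a = 0" and D_ext_zero: "D_ext 0 = 0"
  by (simp_all add: bracket_def D_ext_def zero_prod_def)

lemma vector_space_scale: "vector_space scale"
  ..

text \<open>This is [theta, D]. The last two terms use an argument from \<open>\<hh>\<close>, so
  \<open>Pproj\<close> removes them, but they alone contribute to the next bracket with
  \<open>D\<close>.\<close>

definition bracket1 :: "'g \<times> 'h \<Rightarrow> 'g \<times> 'h \<Rightarrow> 'g \<times> 'h" where
  "bracket1 a b = (0, \<rho> (fst a) (D (fst b)) - \<rho> (fst b) (D (fst a)) - D (\<pi> (fst a) (fst b))
     + \<mu> (D (fst a)) (snd b) - \<mu> (D (fst b)) (snd a))"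

text \<open>This is [[theta, D], D]; antisymmetry of \<mu> makes its two terms equal.\<close>

definition bracket2 :: "'g \<times> 'h \<Rightarrow> 'g \<times> 'h \<Rightarrow> 'g \<times> 'h" where
  "bracket2 a b = (0, \<mu> (D (fst a)) (D (fst b)) + \<mu> (D (fst a)) (D (fst b)))"

lemma nr_bracket_D_ext_1: "nr_bracket scale (binary bracket) (unary D_ext) = binary bracket1"
  by (subst nr_bracket_binary_unary[where B = bracket and T = D_ext,
        OF vector_space_scale bracket_zero D_ext_zero])
    (intro arg_cong[where f = binary] ext, simp add: bracket_def bracket1_def D_ext_def)

lemma nr_bracket_D_ext_2: "nr_bracket scale (binary bracket1) (unary D_ext) = binary bracket2"
proof -
  have "bracket1 0 b = 0" for b
    by (simp add: bracket1_def zero_prod_def)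
  moreover have "bracket1 (D_ext a) b - bracket1 (D_ext b) a - D_ext (bracket1 a b) = bracket2 a b" for a b
    using \<mu>_swap[of "D (fst b)" "D (fst a)"] by (simp add: bracket1_def bracket2_def D_ext_def)
  ultimately show ?thesis
    by (simp add: nr_bracket_binary_unary vector_space_scale D_ext_zero)
qed

text \<open>\<open>bracket2\<close> depends only on first components, which \<open>D_ext\<close>
  makes 0, and its values have first component 0, so \<open>D_ext\<close> kills them.\<close>

lemma nr_bracket_D_ext_3: "nr_bracket scale (binary bracket2) (unary D_ext) = 0"
proof -
  have "bracket2 0 b = 0" for b
    by (simp add: bracket2_def zero_prod_def)
  moreover have "bracket2 (D_ext a) b - bracket2 (D_ext b) a - D_ext (bracket2 a b) = 0" for a b
    by (simp add: bracket2_def D_ext_def zero_prod_def)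
  ultimately show ?thesis
    by (simp add: nr_bracket_binary_unary vector_space_scale D_ext_zero binary_def fun_eq_iff
        split: list.split)
qed

section \<open>The Jacobi identity and LieAct triples\<close>

definition jacobiator :: "'g \<times> 'h \<Rightarrow> 'g \<times> 'h \<Rightarrow> 'g \<times> 'h \<Rightarrow> 'g \<times> 'h" where
  "jacobiator a b c = bracket (bracket a b) c - bracket (bracket a c) b + bracket (bracket b c) a"

text \<open>The bracket is twice the \<open>jacobiator\<close>, and 2 is invertible in
  characteristic 0.\<close>

lemma nr_bracket_self:
  "nr_bracket scale (binary bracket) (binary bracket) = 0 \<longleftrightarrow> (\<forall>a b c. jacobiator a b c = 0)"
  (is "?L \<longleftrightarrow> ?R")
proof
  assume L: ?L
  show ?R
  proof (intro allI)
    fix a b c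
    have "scale 2 (jacobiator a b c) = 0"
      using fun_cong[OF L, of "[a, b, c]"]
      by (simp add: nr_bracket_binary_binary[where B = bracket, OF vector_space_scale bracket_zero] jacobiator_def)
    then show "jacobiator a b c = 0"
      by (simp add: p.scale_eq_0_iff)
  qed
next
  assume ?R
  then show ?L
    by (simp add: nr_bracket_binary_binary[where B = bracket, OF vector_space_scale bracket_zero] fun_eq_iff
        flip: jacobiator_def split: list.split)
qed

text \<open>Evaluation on pure triples separates the axioms: three arguments from one summand give
  its Jacobi identity, one from \<open>\<gg>\<close> and two from \<open>\<hh>\<close> the
  derivation rule, two from \<open>\<gg>\<close> and one from \<open>\<hh>\<close> the homomorphism
  rule.\<close>

lemma jacobiator_eq_0_iff: "(\<forall>a b c. jacobiator a b c = 0) \<longleftrightarrow> lie_act sg \<pi> sh \<mu> \<rho>"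
proof
  assume J: "\<forall>a b c. jacobiator a b c = 0"
  show "lie_act sg \<pi> sh \<mu> \<rho>"
  proof unfold_locales
    show "\<pi> x (\<pi> y z) + \<pi> y (\<pi> z x) + \<pi> z (\<pi> x y) = 0" for x y z
      using J[rule_format, of "(x, 0)" "(y, 0)" "(z, 0)"]
        \<pi>_swap[of x "\<pi> y z"] \<pi>_swap[of y "\<pi> z x"] \<pi>_swap[of z "\<pi> x y"] \<pi>_swap[of z x]
      by (simp add: jacobiator_def bracket_def zero_prod_def algebra_simps)
    show "\<mu> x (\<mu> y z) + \<mu> y (\<mu> z x) + \<mu> z (\<mu> x y) = 0" for x y z
      using J[rule_format, of "(0, x)" "(0, y)" "(0, z)"]
        \<mu>_swap[of x "\<mu> y z"] \<mu>_swap[of y "\<mu> z x"] \<mu>_swap[of z "\<mu> x y"] \<mu>_swap[of z x]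
      by (simp add: jacobiator_def bracket_def zero_prod_def algebra_simps)
    show "derivation sh \<mu> (\<rho> x)" for x
      unfolding derivation_def
    proof (intro conjI allI)
      show "\<rho> x (\<mu> u v) = \<mu> (\<rho> x u) v + \<mu> u (\<rho> x v)" for u v
        using J[rule_format, of "(x, 0)" "(0, u)" "(0, v)"] \<mu>_swap[of u "\<rho> x v"]
        by (simp add: jacobiator_def bracket_def zero_prod_def algebra_simps)
    qed (fact \<rho>_linear)
    show "\<rho> (\<pi> x y) u = \<rho> x (\<rho> y u) - \<rho> y (\<rho> x u)" for x y u
      using J[rule_format, of "(x, 0)" "(y, 0)" "(0, u)"]
      by (simp add: jacobiator_def bracket_def zero_prod_def algebra_simps)
  qed (simp_all add: \<pi> \<mu>)
next
  assume "lie_act sg \<pi> sh \<mu> \<rho>"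
  then interpret L: lie_act sg \<pi> sh \<mu> \<rho> .
  \<comment> \<open>The axioms are brought into the shape of \<open>jacobiator\<close>, with nested
    terms in the first slot, so that the expansion on arbitrary pairs cancels.\<close>
  have \<pi>3: "\<pi> (\<pi> x y) z - \<pi> (\<pi> x z) y + \<pi> (\<pi> y z) x = 0" for x y z
    using L.G.jacobi[of x y z]
      \<pi>_swap[of x "\<pi> y z"] \<pi>_swap[of y "\<pi> z x"] \<pi>_swap[of z "\<pi> x y"] \<pi>_swap[of z x]
    by (simp add: algebra_simps)
  have \<mu>3: "\<mu> (\<mu> x y) z - \<mu> (\<mu> x z) y + \<mu> (\<mu> y z) x = 0" for x y z
    using L.H.jacobi[of x y z]
      \<mu>_swap[of x "\<mu> y z"] \<mu>_swap[of y "\<mu> z x"] \<mu>_swap[of z "\<mu> x y"] \<mu>_swap[of z x]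
    by (simp add: algebra_simps)
  have \<rho>\<mu>: "\<rho> x (\<mu> u v) = \<mu> (\<rho> x u) v - \<mu> (\<rho> x v) u" for x u v
    using L.act_derivation[of x] \<mu>_swap[of u "\<rho> x v"] by (simp add: derivation_def)
  have "jacobiator (x, u) (y, v) (z, w) = 0" for x y z u v w
    using \<pi>3[of x y z] \<mu>3[of u v w]
    by (simp add: jacobiator_def bracket_def \<rho>\<mu> L.act_bracket zero_prod_def algebra_simps)
  then show "\<forall>a b c. jacobiator a b c = 0"
    by auto
qed

section \<open>The candidate element has degree 0\<close>

lemma of_pi_bialt: "of_pi \<pi> \<in> bialt_maps sg sh sg 2 0"
proof -
  have "(\<lambda>xs. of_pi \<pi> xs us) = (if us = [] then binary \<pi> else (\<lambda>_. 0))" for us :: "'h list"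
    by (auto simp: of_pi_def binary_def fun_eq_iff split: list.split)
  then show ?thesis
    using alt_maps_2[OF \<pi>] alt_maps_zero[OF G.vector_space_axioms G.vector_space_axioms]
    by (auto simp: bialt_maps_def of_pi_def intro!: alt_maps_0 split: list.split)
qed

lemma of_mu_bialt: "of_mu \<mu> \<in> bialt_maps sg sh sh 0 2"
proof -
  have "of_mu \<mu> xs = (if xs = [] then binary \<mu> else (\<lambda>_. 0))" for xs :: "'g list"
    by (auto simp: of_mu_def binary_def fun_eq_iff split: list.split)
  then show ?thesis
    using alt_maps_2[OF \<mu>] alt_maps_zero[OF H.vector_space_axioms H.vector_space_axioms]
    by (auto simp: bialt_maps_def intro!: alt_maps_0)
qed

lemma of_rho_bialt: "of_rho \<rho> \<in> bialt_maps sg sh sh 1 1"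
proof -
  have "(\<lambda>xs. of_rho \<rho> xs us) \<in> alt_maps sg sh 1" for us
  proof (cases "length us = 1")
    case True
    then obtain u where "us = [u]" by (auto simp: length_Suc_conv)
    then have "(\<lambda>xs. of_rho \<rho> xs us) = unary (\<lambda>x. \<rho> x u)"
      by (auto simp: of_rho_def unary_def fun_eq_iff split: list.split)
    then show ?thesis by (simp only: alt_maps_1 \<rho>_linear)
  next
    case False
    then have "(\<lambda>xs. of_rho \<rho> xs us) = (\<lambda>_. 0)"
      by (auto simp: of_rho_def fun_eq_iff split: list.split)
    then show ?thesis
      by (simp only: alt_maps_zero[OF G.vector_space_axioms H.vector_space_axioms])
  qed
  moreover have "of_rho \<rho> xs \<in> alt_maps sh sh 1" for xs
  proof (cases "length xs = 1")
    case True
    then obtain x where "xs = [x]" by (auto simp: length_Suc_conv)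
    then have "of_rho \<rho> xs = unary (\<rho> x)"
      by (auto simp: of_rho_def unary_def fun_eq_iff split: list.split)
    then show ?thesis by (simp only: alt_maps_1 \<rho>_linear)
  next
    case False
    then have "of_rho \<rho> xs = (\<lambda>_. 0)"
      by (auto simp: of_rho_def fun_eq_iff split: list.split)
    then show ?thesis
      by (simp only: alt_maps_zero[OF H.vector_space_axioms H.vector_space_axioms])
  qed
  ultimately show ?thesis
    by (simp add: bialt_maps_def)
qed

lemma of_D_bialt: "of_D D \<in> bialt_maps sg sh sh 1 0"
proof -
  have "(\<lambda>xs. of_D D xs us) = (if us = [] then unary D else (\<lambda>_. 0))" for us :: "'h list"
    by (auto simp: of_D_def unary_def fun_eq_iff split: list.split)
  then show ?thesis
    using alt_maps_1[OF D] alt_maps_zero[OF G.vector_space_axioms H.vector_space_axioms]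
    by (auto simp: bialt_maps_def of_D_def intro!: alt_maps_0 split: list.split)
qed

lemma in_sMA_space:
  "(lift_g sg 2 0 (of_pi \<pi>) + lift_h sh 1 1 (of_rho \<rho>) + lift_h sh 0 2 (of_mu \<mu>),
    lift_h sh 1 0 (of_D D)) \<in> sMA_space sg sh 0"
proof -
  have "lift_g sg 2 0 (of_pi \<pi>) + lift_h sh 1 1 (of_rho \<rho>) + lift_h sh 0 2 (of_mu \<mu>) \<in> Mspace sg sh 1"
    unfolding Mspace_def mem_Collect_eq
    \<comment> \<open>Degree 0 in \<open>sM'\<close> is degree 1 in \<open>M'\<close>, so
      \<open>k\<close> takes only the value 1 and a constant family suffices.\<close>
    by (rule exI[of _ "of_pi \<pi>"], rule exI[of _ "\<lambda>_. of_rho \<rho>"], rule exI[of _ "of_mu \<mu>"])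
      (use of_pi_bialt of_rho_bialt of_mu_bialt in \<open>simp add: numeral_2_eq_2\<close>)
  moreover have "lift_h sh 1 0 (of_D D) \<in> Aspace sg sh 0"
    using of_D_bialt by (auto simp: Aspace_def)
  ultimately show ?thesis
    by (simp add: sMA_space_def)
qed

section \<open>Evaluation of the Maurer-Cartan series\<close>

lemma Pproj_bracket1: "Pproj (binary bracket1) =
  binary (\<lambda>a b. (0, \<rho> (fst a) (D (fst b)) - \<rho> (fst b) (D (fst a)) - D (\<pi> (fst a) (fst b))))"
  by (auto simp: Pproj_def binary_def bracket1_def fun_eq_iff zero_prod_def split: list.split)

lemma Pproj_bracket2: "Pproj (binary bracket2) = binary bracket2"
  by (auto simp: Pproj_def binary_def bracket2_def fun_eq_iff zero_prod_def split: list.split)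

lemma l_MA_D_ext_ge_3:
  assumes "n \<ge> 3"
  shows "l_MA sg sh wt (binary bracket) (replicate n (unary D_ext)) = 0"
proof -
  have zero: "foldl (nr_bracket scale) 0 (replicate k (unary D_ext)) = 0" for k
  proof (induction k)
    case (Suc k)
    \<comment> \<open>The zero map is written as a \<open>binary\<close> so that
      \<open>nr_bracket_binary_unary\<close> applies; further brackets then stay 0.\<close>
    have "nr_bracket scale 0 (unary D_ext) = nr_bracket scale (binary (\<lambda>_ _. 0)) (unary D_ext)"
      by (intro arg_cong2[where f = "nr_bracket scale"]) (auto simp: binary_def fun_eq_iff split: list.split)
    also have "\<dots> = 0"
      by (subst nr_bracket_binary_unary[where T = D_ext, OF vector_space_scale _ D_ext_zero])
        (auto simp: D_ext_zero binary_def fun_eq_iff split: list.split)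
    finally show ?case using Suc by (simp only: replicate_Suc foldl_Cons)
  qed simp
  obtain k where "n = Suc (Suc (Suc k))"
    using assms by (metis add_Suc_right le_Suc_ex plus_nat.add_0 add_Suc numeral_3_eq_3)
  then show ?thesis
    by (simp add: l_MA_def Let_def scale_map_def nr_bracket_D_ext_1 nr_bracket_D_ext_2
        nr_bracket_D_ext_3 zero Pproj_def fun_eq_iff flip: zero_prod_def)
qed

lemma maurer_cartan_iff:
  "maurer_cartan sg sh wt (binary bracket, unary D_ext) \<longleftrightarrow>
   (binary bracket, unary D_ext) \<in> sMA_space sg sh 0 \<and>
   nr_bracket scale (binary bracket) (binary bracket) = 0 \<and> rel_diff_op sg \<pi> sh \<mu> \<rho> wt D"
proof -
  define l where "l n = l_op sg sh wt (replicate n (0, binary bracket, unary D_ext))" for n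
  define weighted where "weighted n =
    map_prod (scale_map scale (1 / fact n)) (scale_map scale (1 / fact n)) (l n)" for n
  let ?N = "{n. n \<ge> 1 \<and> l n \<noteq> 0}"
  note l_op = l_op_replicate[OF G.vector_space_axioms H.vector_space_axioms]
  \<comment> \<open>The mixed part of \<open>l n\<close> contains \<open>n - 1\<close> copies of
    \<open>D\<close>, hence vanishes for \<open>n \<ge> 4\<close>.\<close>
  have l_zero: "l n = 0" if "n \<notin> {2, 3}" for n
    using that l_MA_D_ext_ge_3[of "n - 1" wt]
    by (cases "n \<ge> 2") (auto simp: l_def l_op zero_prod_def)
  then have sub: "?N \<subseteq> {2, 3}" by blast
  have "map_prod (scale_map scale c) (scale_map scale c) 0 = 0" for c
    by (simp add: scale_map_def prod_eq_iff fun_eq_iff)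
  \<comment> \<open>\<open>?N\<close> may be smaller than \<open>{2, 3}\<close>; the indices added
    to it contribute 0.\<close>
  then have "weighted n = 0" if "n \<in> {2, 3} - ?N" for n
    using that by (auto simp: weighted_def)
  with sub have sum: "sum weighted ?N = weighted 2 + weighted 3"
    by (subst sum.mono_neutral_left[of "{2, 3}"]) auto
  let ?J = "nr_bracket scale (binary bracket) (binary bracket)"
  let ?E = "\<lambda>(a :: 'g \<times> 'h) (b :: 'g \<times> 'h). (0 :: 'g,
    \<rho> (fst a) (D (fst b)) - \<rho> (fst b) (D (fst a)) - D (\<pi> (fst a) (fst b))
    + sh wt (\<mu> (D (fst a)) (D (fst b))))"
  \<comment> \<open>The minus sign is \<open>(-1) powi 1\<close> in \<open>l_MM\<close>, the half is
    1/2!, and \<open>l 3\<close> has no \<open>sM'\<close>-component.\<close>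
  have fst: "fst (weighted 2 + weighted 3) = scale_map scale (- 1 / 2) ?J"
    by (simp add: weighted_def l_def l_op l_MM_def Let_def scale_map_def fun_eq_iff flip: p.scale_minus_left)
  \<comment> \<open>The \<open>n\<close> equal mixed terms turn the weight \<open>1 / fact n\<close>
    into \<open>1 / fact (n - 1)\<close>: 1 for \<open>n = 2\<close> and 1/2 for
    \<open>n = 3\<close>.\<close>
  have half: "scale (1 / 2) (x + x) = x" for x
    by (simp add: p.scale_right_distrib flip: p.scale_left_distrib)
  have sixth: "scale (1 / 6) (x + x + x) = scale (1 / 2) x" for x
    by (simp add: p.scale_right_distrib flip: p.scale_left_distrib)
  have "l_MA sg sh wt (binary bracket) [unary D_ext] = Pproj (binary bracket1)"
    by (simp add: l_MA_def Let_def scale_map_def nr_bracket_D_ext_1)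
  moreover have "{..<2::nat} = {0, 1}" by auto
  ultimately have snd2: "snd (weighted 2) = Pproj (binary bracket1)"
    by (simp add: weighted_def l_def l_op scale_map_def half fun_eq_iff)
  have "l_MA sg sh wt (binary bracket) [unary D_ext, unary D_ext] =
      scale_map scale wt (binary bracket2)"
    by (simp add: l_MA_def Let_def scale_map_def nr_bracket_D_ext_1 nr_bracket_D_ext_2 Pproj_bracket2)
  moreover have "replicate 2 (unary D_ext) = [unary D_ext, unary D_ext]"
    by (simp add: numeral_2_eq_2)
  moreover have "{..<3::nat} = {0, 1, 2}" by auto
  ultimately have "snd (weighted 3) = (\<lambda>xs. scale (1 / 2) (scale wt (binary bracket2 xs)))"
    by (simp add: weighted_def l_def l_op scale_map_def fun_eq_iff fact_numeral sixth flip: add.assoc)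
  \<comment> \<open>The remaining 1/2 cancels the doubling in \<open>bracket2\<close>.\<close>
  also have "\<dots> = binary (\<lambda>a b. (0, sh wt (\<mu> (D (fst a)) (D (fst b)))))"
    by (auto simp: fun_eq_iff binary_def bracket2_def scale_prod H.scale_right_distrib
        simp flip: H.scale_left_distrib zero_prod_def split: list.split)
  finally have snd3: "snd (weighted 3) = binary (\<lambda>a b. (0, sh wt (\<mu> (D (fst a)) (D (fst b)))))" .
  have snd: "snd (weighted 2 + weighted 3) = binary ?E"
    by (auto simp: snd2 snd3 Pproj_bracket1 fun_eq_iff binary_def split: list.split)
  have "scale_map scale (- 1 / 2) ?J = 0 \<longleftrightarrow> ?J = 0"
    by (auto simp: scale_map_def fun_eq_iff)
  moreover have "binary ?E = 0 \<longleftrightarrow> rel_diff_op sg \<pi> sh \<mu> \<rho> wt D"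
  proof
    assume E: "binary ?E = 0"
    have "D (\<pi> x y) = \<rho> x (D y) - \<rho> y (D x) + sh wt (\<mu> (D x) (D y))" for x y
      using fun_cong[OF E, of "[(x, 0), (y, 0)]"] by (simp add: zero_prod_def algebra_simps)
    then show "rel_diff_op sg \<pi> sh \<mu> \<rho> wt D"
      using D by (simp add: rel_diff_op_def)
  next
    assume "rel_diff_op sg \<pi> sh \<mu> \<rho> wt D"
    then show "binary ?E = 0"
      by (auto simp: rel_diff_op_def binary_def fun_eq_iff zero_prod_def split: list.split)
  qed
  moreover have "finite ?N" using sub by (rule finite_subset) simp
  ultimately show ?thesis
    unfolding maurer_cartan_def Let_def
    using sum fst snd by (simp add: l_def weighted_def prod_eq_iff)
qed

end

theorem theorem4p16:
  fixes sg :: "'k::field_char_0 \<Rightarrow> 'g::ab_group_add \<Rightarrow> 'g"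
    and sh :: "'k \<Rightarrow> 'h::ab_group_add \<Rightarrow> 'h"
    and wt :: 'k
    and \<pi> :: "'g \<Rightarrow> 'g \<Rightarrow> 'g" and \<rho> :: "'g \<Rightarrow> 'h \<Rightarrow> 'h" and \<mu> :: "'h \<Rightarrow> 'h \<Rightarrow> 'h"
    and D :: "'g \<Rightarrow> 'h"
  assumes "vector_space sg" and "vector_space sh"
    and "alternating_bilinear sg \<pi>"
    and "bilinear_map sg sh sh \<rho>"
    and "alternating_bilinear sh \<mu>"
    and "Vector_Spaces.linear sg sh D"
  shows "maurer_cartan sg sh wt
           (lift_g sg 2 0 (of_pi \<pi>) + lift_h sh 1 1 (of_rho \<rho>) + lift_h sh 0 2 (of_mu \<mu>),
            lift_h sh 1 0 (of_D D))
         \<longleftrightarrow> lie_act sg \<pi> sh \<mu> \<rho> \<and> rel_diff_op sg \<pi> sh \<mu> \<rho> wt D"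
proof -
  interpret lie_act_data sg sh \<pi> \<rho> \<mu> D
    using assms by (simp add: lie_act_data_def lie_act_data_axioms_def)
  show ?thesis
    \<comment> \<open>The degree condition in \<open>maurer_cartan_iff\<close> always holds here,
      which leaves the two component equations.\<close>
    using in_sMA_space
    unfolding lift_structure lift_D maurer_cartan_iff nr_bracket_self jacobiator_eq_0_iff
    by blast
qed

end
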